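(* Let $X$ be an infinite Tychonoff space and let $G$ be a non-trivial metrizable arc-connected topological group. Then the following are equivalent: (a) Player II has a winning strategy in the $\Omega$-Rothberger game $G_{1}(\Omega(X),\Omega(X))$. (b) Player II has a winning strategy in the countable strong fan tightness game $SCFT(C_p(X,G),\mathbf{e})$.
   Context: Tychonoff means completely regular Hausdorff. $G$ has identity element $e$; arc-connected means that for any two distinct points of $G$ there is a topological embedding $[0,1]\hookrightarrow G$ joining them (in particular for each $g\in G\setminus\{e\}$ there is an embedding $\gamma:[0,1]\hookrightarrow G$ with $\gamma(0)=e$, $\gamma(1)=g$). $C_p(X,G)$ is the space of all continuous functions $X\to G$ with the topology of pointwise convergence, and $\mathbf{e}\in C_p(X,G)$ is the constant function with value $e$. An open cover $\mathcal{U}$ of $X$ is an $\omega$-cover if $X\notin\mathcal{U}$ and every finite subset of $X$ is contained in some member of $\mathcal{U}$; $\Omega(X)$ is the collection of all $\omega$-covers of $X$. For a space $Y$ and $y\in Y$, $\Omega_y=\{A\subset Y: y\in\overline{A}\setminus A\}$. For collections $\mathcal{A},\mathcal{B}$ of subsets of an infinite set, the game $G_{1}(\mathcal{A},\mathcal{B})$ is played in innings $n\in\mathbb{N}=\{1,2,\dots\}$: in inning $n$ Player I selects $A_n\in\mathcal{A}$ and Player II responds with a single element $b_n\in A_n$. Player II wins if $\{b_n:n\in\mathbb{N}\}\in\mathcal{B}$; otherwise Player I wins. A strategy for Player II is a function $\sigma$ on $\bigcup_{n\ge1}\mathcal{A}^n$ with $\sigma(A_1,\dots,A_n)\in A_n$;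 it is winning if, for every sequence $(A_n)_{n}$ of elements of $\mathcal{A}$ played by Player I, Player II wins by responding with $b_n=\sigma(A_1,\dots,A_n)$ in each inning $n$. The countable strong fan tightness game is $SCFT(Y,y):=G_{1}(\Omega_y,\Omega_y)$: in inning $n$ Player I chooses $A_n\subset Y\setminus\{y\}$ with $y\in\overline{A_n}$, Player II chooses a single $b_n\in A_n$, and Player II wins if $y\in\overline{\{b_n:n\in\mathbb{N}\}}$. *)

theory Defs
  imports "HOL-Analysis.Analysis"
begin

definition Tychonoff_space :: "'a topology \<Rightarrow> bool" where
  "Tychonoff_space X \<longleftrightarrow> completely_regular_space X \<and> Hausdorff_space X"

definition arc_connected_space :: "'a topology \<Rightarrow> bool" where
  "arc_connected_space Y \<longleftrightarrow>
     (\<forall>a\<in>topspace Y. \<forall>b\<in>topspace Y. a \<noteq> b \<longrightarrow>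
        (\<exists>\<gamma>::real \<Rightarrow> 'a. embedding_map (top_of_set {0..1}) Y \<gamma> \<and> \<gamma> 0 = a \<and> \<gamma> 1 = b))"

text \<open>The points of \<open>product_topology (\<lambda>_. Y) (topspace X)\<close> are the functions from the carrier
  of \<open>X\<close> to the carrier of \<open>Y\<close> that are \<open>undefined\<close> outside the carrier of \<open>X\<close>; each function
  on the carrier is thus represented exactly once.\<close>

definition Cp :: "'a topology \<Rightarrow> 'b topology \<Rightarrow> ('a \<Rightarrow> 'b) topology" where
  "Cp X Y = subtopology (product_topology (\<lambda>_. Y) (topspace X)) {f. continuous_map X Y f}"

definition Cp_const :: "'a topology \<Rightarrow> 'b \<Rightarrow> 'a \<Rightarrow> 'b" where
  "Cp_const X c = restrict (\<lambda>_. c) (topspace X)"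

definition omega_cover :: "'a topology \<Rightarrow> 'a set set \<Rightarrow> bool" where
  "omega_cover X \<U> \<longleftrightarrow>
     (\<forall>U\<in>\<U>. openin X U) \<and> \<Union>\<U> = topspace X \<and> topspace X \<notin> \<U> \<and>
     (\<forall>F. finite F \<and> F \<subseteq> topspace X \<longrightarrow> (\<exists>U\<in>\<U>. F \<subseteq> U))"

definition omega_covers :: "'a topology \<Rightarrow> 'a set set set" where
  "omega_covers X = {\<U>. omega_cover X \<U>}"

definition Omega_at :: "'a topology \<Rightarrow> 'a \<Rightarrow> 'a set set" where
  "Omega_at Y y = {A. A \<subseteq> topspace Y \<and> y \<in> Y closure_of A - A}"

text \<open>In the game \<open>G\<^sub>1(\<A>, \<B>)\<close> a strategy of Player II maps the nonempty finite sequence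
  (a list, oldest move first) of the moves made so far by Player I to an element of the last one.
  Its values on other lists are irrelevant. Innings are numbered from \<open>0\<close>.\<close>

definition G1_strategy_II :: "'b set set \<Rightarrow> ('b set list \<Rightarrow> 'b) \<Rightarrow> bool" where
  "G1_strategy_II \<A> \<sigma> \<longleftrightarrow> (\<forall>As. As \<noteq> [] \<and> set As \<subseteq> \<A> \<longrightarrow> \<sigma> As \<in> last As)"

definition G1_winning_strategy_II :: "'b set set \<Rightarrow> 'b set set \<Rightarrow> ('b set list \<Rightarrow> 'b) \<Rightarrow> bool" where
  "G1_winning_strategy_II \<A> \<B> \<sigma> \<longleftrightarrow>
     G1_strategy_II \<A> \<sigma> \<and>
     (\<forall>A::nat \<Rightarrow> 'b set. (\<forall>n. A n \<in> \<A>) \<longrightarrow> {\<sigma> (map A [0..<Suc n]) |n. True} \<in> \<B>)"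

definition II_has_winning_strategy_G1 :: "'b set set \<Rightarrow> 'b set set \<Rightarrow> bool" where
  "II_has_winning_strategy_G1 \<A> \<B> \<longleftrightarrow> (\<exists>\<sigma>. G1_winning_strategy_II \<A> \<B> \<sigma>)"

definition II_has_winning_strategy_SCFT :: "'b topology \<Rightarrow> 'b \<Rightarrow> bool" where
  "II_has_winning_strategy_SCFT Y y \<longleftrightarrow> II_has_winning_strategy_G1 (Omega_at Y y) (Omega_at Y y)"

end

theory Submission
  imports Defs
begin

text \<open>
  A set \<open>A\<close> of functions clusters at the constant function \<open>c\<close> iff for every neighbourhood \<open>O\<close> of
  \<open>c\<close> the sets \<open>f\<^sup>-\<^sup>1(O)\<close>, \<open>f \<in> A\<close>, catch all finite sets. Let \<open>B\<^sub>n\<close> be a decreasing neighbourhood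
  base at \<open>c\<close>. A winning strategy for \<open>\<omega>\<close>-covers is transferred to the function space by
  answering, in inning \<open>n\<close>, the cover by the sets \<open>f\<^sup>-\<^sup>1(B\<^sub>n) - {x}\<close>; deleting a point keeps the
  whole space out of the cover, and it forces every finite set to be caught in arbitrarily late
  innings. Conversely, fix \<open>g \<noteq> c\<close> and translate an \<open>\<omega>\<close>-cover \<open>\<U>\<close> into the set of functions that
  are constantly \<open>g\<close> off some member of \<open>\<U>\<close>; it clusters at \<open>c\<close> because Urysohn functions
  composed with an arc from \<open>c\<close> to \<open>g\<close> provide enough such functions.
\<close>

section \<open>Clustering at a constant function in the pointwise topology\<close>

lemma topspace_Cp:
  "topspace (Cp X Y) = {f \<in> topspace X \<rightarrow>\<^sub>E topspace Y. continuous_map X Y f}"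
  by (auto simp: Cp_def)

lemma Cp_const_in_topspace:
  "c \<in> topspace Y \<Longrightarrow> Cp_const X c \<in> topspace (Cp X Y)"
  by (auto simp: topspace_Cp Cp_const_def intro: continuous_map_eq[of X Y "\<lambda>_. c"])

text \<open>A basic open set of the product restricts only finitely many coordinates. Because the
  function is constant, the neighbourhoods at these coordinates all contain the same point
  \<open>c\<close> and can be intersected, so one \<open>V\<close> serves all of
  \<open>F\<close>.\<close>

lemma Cp_const_in_closure_of_iff:
  assumes c: "c \<in> topspace Y" and A: "A \<subseteq> topspace (Cp X Y)"
  shows "Cp_const X c \<in> Cp X Y closure_of A \<longleftrightarrow>
    (\<forall>F V. finite F \<and> F \<subseteq> topspace X \<and> openin Y V \<and> c \<in> V \<longrightarrow> (\<exists>f\<in>A. f ` F \<subseteq> V))"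
    (is "?L \<longleftrightarrow> ?R")
proof
  assume ?L
  then have L: "\<exists>f. f \<in> A \<and> f \<in> S" if "Cp_const X c \<in> S" "openin (Cp X Y) S" for S
    using that by (simp add: in_closure_of)
  show ?R
  proof (intro allI impI, elim conjE)
    fix F V assume F: "finite F" "F \<subseteq> topspace X" and V: "openin Y V" "c \<in> V"
    let ?W = "\<lambda>x. if x \<in> F then V else topspace Y"
    have "openin (product_topology (\<lambda>_. Y) (topspace X)) (PiE (topspace X) ?W)"
      unfolding openin_PiE_gen using F(1) V
      by (intro disjI2 conjI) (auto intro: rev_finite_subset[of F])
    then have "openin (Cp X Y) (PiE (topspace X) ?W \<inter> {f. continuous_map X Y f})"
      unfolding Cp_def by (metis openin_subtopology)
    moreover have "Cp_const X c \<in> PiE (topspace X) ?W \<inter> {f. continuous_map X Y f}"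
      using Cp_const_in_topspace[OF c, of X] V c by (auto simp: topspace_Cp Cp_const_def)
    ultimately obtain f where "f \<in> A" "f \<in> PiE (topspace X) ?W"
      using L by (metis IntD1)
    moreover have "f x \<in> V" if "x \<in> F" for x
      using PiE_mem[OF \<open>f \<in> PiE (topspace X) ?W\<close>, of x] F(2) that by auto
    ultimately show "\<exists>f\<in>A. f ` F \<subseteq> V"
      by blast
  qed
next
  assume R: ?R
  show ?L
    unfolding in_closure_of
  proof (intro conjI allI impI, rule Cp_const_in_topspace[OF c], elim conjE)
    fix T assume T: "Cp_const X c \<in> T" "openin (Cp X Y) T"
    have "\<exists>T'. openin (product_topology (\<lambda>_. Y) (topspace X)) T' \<and>
        T = T' \<inter> {f. continuous_map X Y f}"
      using T(2) by (simp add: Cp_def openin_subtopology)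
    then obtain T' where T': "openin (product_topology (\<lambda>_. Y) (topspace X)) T'"
        "T = T' \<inter> {f. continuous_map X Y f}"
      by metis
    have "\<exists>U. finite {x \<in> topspace X. U x \<noteq> topspace Y} \<and>
        (\<forall>x\<in>topspace X. openin Y (U x)) \<and>
        Cp_const X c \<in> PiE (topspace X) U \<and> PiE (topspace X) U \<subseteq> T'"
      using T(1) T' by (simp add: openin_product_topology_alt)
    then obtain U where U: "finite {x \<in> topspace X. U x \<noteq> topspace Y}"
        "\<And>x. x \<in> topspace X \<Longrightarrow> openin Y (U x)"
        "Cp_const X c \<in> PiE (topspace X) U" "PiE (topspace X) U \<subseteq> T'"
      by metis
    define F where "F = {x \<in> topspace X. U x \<noteq> topspace Y}"
    define V where "V = topspace Y \<inter> (\<Inter>x\<in>F. U x)"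
    have cU: "c \<in> U x" if "x \<in> topspace X" for x
      using PiE_mem[OF U(3) that] that by (simp add: Cp_const_def)
    have V: "openin Y V"
    \<comment> \<open>The intersection over an empty index set is \<open>UNIV\<close>, whereas
      \<open>openin_INT2\<close> asks for a nonempty index set. For empty \<open>F\<close> the set
      \<open>V\<close> is simply \<open>topspace Y\<close>.\<close>
    proof (cases "F = {}")
      case False
      then show ?thesis
        unfolding V_def using U(1,2)
        by (intro openin_Int openin_topspace openin_INT2) (auto simp: F_def)
    qed (simp add: V_def)
    moreover have "c \<in> V"
      using c cU by (auto simp: V_def F_def)
    ultimately obtain f where f: "f \<in> A" "f ` F \<subseteq> V"
      using R U(1) unfolding F_def by (metis (no_types, lifting) mem_Collect_eq subsetI)
    have fC: "f \<in> topspace X \<rightarrow>\<^sub>E topspace Y" "continuous_map X Y f"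
      using f(1) A by (auto simp: topspace_Cp)
    have "f \<in> PiE (topspace X) U"
    proof (rule PiE_I)
      fix x assume x: "x \<in> topspace X"
      show "f x \<in> U x"
      proof (cases "x \<in> F")
        case True
        then show ?thesis using f(2) by (auto simp: V_def)
      next
        case False
        then show ?thesis using x fC(1) by (auto simp: F_def PiE_iff)
      qed
    qed (use fC(1) in \<open>auto simp: PiE_iff extensional_def\<close>)
    then show "\<exists>f. f \<in> A \<and> f \<in> T"
      using f(1) fC(2) U(4) T'(2) by blast
  qed
qed

section \<open>Neighbourhood sequences, sequences of cover members, and transfer of
  strategies\<close>

text \<open>Balls of radius \<open>1/(n+1)\<close> around \<open>c\<close> decrease, so once one
  lies in \<open>V\<close> all later ones do. This eventual form matters because the inning in which
  a finite set is caught cannot be prescribed, only bounded below.\<close>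

lemma metrizable_space_neighbourhood_sequence:
  assumes "metrizable_space Y" and "c \<in> topspace Y"
  shows "\<exists>B :: nat \<Rightarrow> 'b set. (\<forall>n. openin Y (B n) \<and> c \<in> B n) \<and>
    (\<forall>V. openin Y V \<longrightarrow> c \<in> V \<longrightarrow> (\<exists>m. \<forall>n\<ge>m. B n \<subseteq> V))"
proof -
  obtain M d where "Metric_space M d" and Y: "Y = Metric_space.mtopology M d"
    using assms(1) unfolding metrizable_space_def by blast
  then interpret Metric_space M d by simp
  show ?thesis
  proof (intro exI[of _ "\<lambda>n. mball c (inverse (real (Suc n)))"] conjI allI impI)
    fix V assume "openin Y V" "c \<in> V"
    then obtain r where r: "r > 0" "mball c r \<subseteq> V"
      unfolding Y openin_mtopology by blast
    obtain m where m: "inverse (real (Suc m)) < r"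
      using reals_Archimedean[OF r(1)] by blast
    have "mball c (inverse (real (Suc n))) \<subseteq> V" if "n \<ge> m" for n
    proof -
      have "inverse (real (Suc n)) \<le> inverse (real (Suc m))"
        using that by (simp add: field_simps)
      then show ?thesis
        using m r(2) mball_subset_concentric[of "inverse (real (Suc n))" r c] by (meson order.strict_implies_order order_trans)
    qed
    then show "\<exists>m. \<forall>n\<ge>m. mball c (inverse (real (Suc n))) \<subseteq> V" by blast
  qed (use assms(2) Y in auto)
qed

text \<open>Every \<open>V n\<close> misses some point \<open>x n\<close>. Adding
  \<open>x 0\<close>, ..., \<open>x (m - 1)\<close> to \<open>F\<close> gives a finite set that none
  of the first \<open>m\<close> members can contain.\<close>

lemma omega_cover_sequence_frequently:
  fixes V :: "nat \<Rightarrow> 'a set"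
  assumes cov: "omega_cover X (range V)" and F: "finite F" "F \<subseteq> topspace X"
  shows "\<exists>n\<ge>m. F \<subseteq> V n"
proof -
  have "\<exists>x. x \<in> topspace X \<and> x \<notin> V n" for n
    using cov unfolding omega_cover_def
    by (metis openin_subset rangeI subsetI subset_antisym)
  then obtain x where x: "\<And>n. x n \<in> topspace X" "\<And>n. x n \<notin> V n"
    by metis
  have "finite (F \<union> x ` {..<m}) \<and> F \<union> x ` {..<m} \<subseteq> topspace X"
    using F x(1) by auto
  then obtain n where n: "F \<union> x ` {..<m} \<subseteq> V n"
    using cov unfolding omega_cover_def by (metis rangeE)
  then have "\<not> n < m"
    using x(2)[of n] by blast
  then show ?thesis
    using n by (auto simp: not_less)
qed

text \<open>Player II simulates the game with known strategy: \<open>T\<close> turns each move of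
  Player I into a move of that game, and \<open>R\<close> turns the answer found there into a legal
  answer to the original move. \<open>D\<close> then only has to compare the two outcomes of a whole
  play.\<close>

lemma II_has_winning_strategy_G1_transfer:
  fixes T :: "nat \<Rightarrow> 'b set \<Rightarrow> 'a set" and R :: "nat \<Rightarrow> 'b set \<Rightarrow> 'a \<Rightarrow> 'b"
  assumes win: "II_has_winning_strategy_G1 \<A> \<B>"
    and T: "\<And>n C. C \<in> \<C> \<Longrightarrow> T n C \<in> \<A>"
    and R: "\<And>n C a. C \<in> \<C> \<Longrightarrow> a \<in> T n C \<Longrightarrow> R n C a \<in> C"
    and D: "\<And>C a. (\<And>n. C n \<in> \<C>) \<Longrightarrow> (\<And>n. a n \<in> T n (C n)) \<Longrightarrow> range a \<in> \<B> \<Longrightarrow>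
              range (\<lambda>n. R n (C n) (a n)) \<in> \<D>"
  shows "II_has_winning_strategy_G1 \<C> \<D>"
proof -
  obtain \<sigma> where strat: "\<And>As. As \<noteq> [] \<Longrightarrow> set As \<subseteq> \<A> \<Longrightarrow> \<sigma> As \<in> last As"
    and wins: "\<And>A. (\<And>n::nat. A n \<in> \<A>) \<Longrightarrow> {\<sigma> (map A [0..<Suc n]) |n. True} \<in> \<B>"
    using win unfolding II_has_winning_strategy_G1_def G1_winning_strategy_II_def
      G1_strategy_II_def by blast
  define tr where "tr Cs = map (\<lambda>i. T i (Cs ! i)) [0..<length Cs]" for Cs
  \<comment> \<open>\<open>length Cs - 1\<close> is the number of the current inning, counted from
    0.\<close>
  define \<rho> where "\<rho> Cs = R (length Cs - 1) (last Cs) (\<sigma> (tr Cs))" for Cs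
  have tr_move: "\<sigma> (tr Cs) \<in> T (length Cs - 1) (last Cs)" if "Cs \<noteq> []" "set Cs \<subseteq> \<C>" for Cs
  proof -
    have "tr Cs \<noteq> []" using that(1) by (simp add: tr_def)
    moreover have "set (tr Cs) \<subseteq> \<A>" using that(2) T by (auto simp: tr_def subset_iff)
    moreover have "last (tr Cs) = T (length Cs - 1) (last Cs)"
      using that(1) by (simp add: tr_def last_map last_conv_nth)
    ultimately show ?thesis using strat[of "tr Cs"] by simp
  qed
  have "G1_strategy_II \<C> \<rho>"
    unfolding G1_strategy_II_def \<rho>_def
    using tr_move R by (meson last_in_set subsetD)
  moreover have "{\<rho> (map C [0..<Suc n]) |n. True} \<in> \<D>" if C: "\<And>n. C n \<in> \<C>" for C
  proof -
    define a where "a n = \<sigma> (map (\<lambda>i. T i (C i)) [0..<Suc n])" for n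
    \<comment> \<open>Moves are translated one by one, so the prefixes of a play become the prefixes
      of a single simulated play, to which \<open>wins\<close> applies.\<close>
    have tr_eq: "tr (map C [0..<Suc n]) = map (\<lambda>i. T i (C i)) [0..<Suc n]" for n
      unfolding tr_def by (rule nth_equalityI) (auto simp del: upt_Suc)
    have "a n \<in> T n (C n)" for n
      using tr_move[of "map C [0..<Suc n]"] C unfolding a_def tr_eq by auto
    moreover have "range a \<in> \<B>"
      using wins[of "\<lambda>i. T i (C i)"] T C by (simp add: a_def full_SetCompr_eq)
    ultimately have "range (\<lambda>n. R n (C n) (a n)) \<in> \<D>"
      using D C by blast
    moreover have "\<rho> (map C [0..<Suc n]) = R n (C n) (a n)" for n
      unfolding \<rho>_def a_def tr_eq by simp
    ultimately show ?thesis
      by (simp add: full_SetCompr_eq)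
  qed
  ultimately show ?thesis
    unfolding II_has_winning_strategy_G1_def G1_winning_strategy_II_def by blast
qed

section \<open>From omega-covers to fan tightness\<close>

text \<open>Some \<open>f\<close> may map all of the space into \<open>V\<close>, hence the removal
  of a point. Infinity of the space allows that point to be chosen outside a given finite set, and
  T1 keeps the remaining set open.\<close>

lemma omega_cover_preimages_minus_point:
  assumes X: "t1_space X" "infinite (topspace X)" and c: "c \<in> topspace Y"
    and A: "A \<in> Omega_at (Cp X Y) (Cp_const X c)" and V: "openin Y V" "c \<in> V"
  shows "omega_cover X {{z \<in> topspace X. f z \<in> V} - {x} |f x. f \<in> A \<and> x \<in> topspace X}"
proof -
  define W where "W = {{z \<in> topspace X. f z \<in> V} - {x} |f x. f \<in> A \<and> x \<in> topspace X}"
  have A': "A \<subseteq> topspace (Cp X Y)" "Cp_const X c \<in> Cp X Y closure_of A"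
    using A by (auto simp: Omega_at_def)
  have small: "\<exists>U\<in>W. F \<subseteq> U" if F: "finite F" "F \<subseteq> topspace X" for F
  proof -
    obtain f where f: "f \<in> A" "f ` F \<subseteq> V"
      using iffD1[OF Cp_const_in_closure_of_iff[OF c A'(1)] A'(2), rule_format, of F V] F V by auto
    obtain x where "x \<in> topspace X" "x \<notin> F"
      using X(2) F by (metis finite_subset subsetI)
    then have "{z \<in> topspace X. f z \<in> V} - {x} \<in> W" "F \<subseteq> {z \<in> topspace X. f z \<in> V} - {x}"
      using f F by (auto simp: W_def)
    then show ?thesis by blast
  qed
  have op: "openin X U" if U_mem: "U \<in> W" for U
  proof -
    obtain f x where U: "U = {z \<in> topspace X. f z \<in> V} - {x}" "f \<in> A" "x \<in> topspace X"
      using U_mem unfolding W_def by blast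
    have "openin X {z \<in> topspace X. f z \<in> V}"
      using A'(1) U(2) V(1) by (auto simp: topspace_Cp intro: openin_continuous_map_preimage)
    moreover have "closedin X {x}"
      using X(1) U(3) by (simp add: t1_space_closedin_singleton)
    ultimately show ?thesis
      unfolding U(1) by (rule openin_diff)
  qed
  have "topspace X \<subseteq> \<Union>W"
  proof
    fix x assume "x \<in> topspace X"
    then show "x \<in> \<Union>W" using small[of "{x}"] by auto
  qed
  then have "\<Union>W = topspace X"
    using op openin_subset by blast
  moreover have "topspace X \<notin> W"
    unfolding W_def by blast
  ultimately have "omega_cover X W"
    unfolding omega_cover_def using op small by simp
  then show ?thesis
    unfolding W_def .
qed

lemma SCFT_if_omega_Rothberger:
  assumes X: "t1_space X" "infinite (topspace X)"
    and Y: "metrizable_space Y" and c: "c \<in> topspace Y"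
    and win: "II_has_winning_strategy_G1 (omega_covers X) (omega_covers X)"
  shows "II_has_winning_strategy_SCFT (Cp X Y) (Cp_const X c)"
proof -
  obtain B :: "nat \<Rightarrow> 'b set" where "\<forall>n. openin Y (B n) \<and> c \<in> B n"
    and B_small: "\<forall>V. openin Y V \<longrightarrow> c \<in> V \<longrightarrow> (\<exists>m. \<forall>n\<ge>m. B n \<subseteq> V)"
    using metrizable_space_neighbourhood_sequence[OF Y c] by metis
  then have B: "openin Y (B n)" "c \<in> B n" for n
    by simp_all
  define T where
    "T n A = {{z \<in> topspace X. f z \<in> B n} - {x} |f x. f \<in> A \<and> x \<in> topspace X}"
    for n and A :: "('a \<Rightarrow> 'b) set"
  \<comment> \<open>The same \<open>U\<close> can arise from several pairs of a function and a
    deleted point; any \<open>f\<close> in \<open>A\<close> mapping \<open>U\<close> into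
    \<open>B n\<close> is a good answer.\<close>
  define R where "R n A U = (SOME f. f \<in> A \<and> f ` U \<subseteq> B n)"
    for n :: nat and A :: "('a \<Rightarrow> 'b) set" and U :: "'a set"
  have R: "R n A U \<in> A \<and> R n A U ` U \<subseteq> B n" if "U \<in> T n A" for n A U
  proof -
    have "\<exists>f. f \<in> A \<and> f ` U \<subseteq> B n"
      using that unfolding T_def by blast
    then show ?thesis
      unfolding R_def by (rule someI_ex)
  qed
  show ?thesis
    unfolding II_has_winning_strategy_SCFT_def
  proof (rule II_has_winning_strategy_G1_transfer[OF win, where T = T and R = R])
    show "T n A \<in> omega_covers X" if "A \<in> Omega_at (Cp X Y) (Cp_const X c)" for n A
      using omega_cover_preimages_minus_point[OF X c that B]
      by (simp add: omega_covers_def T_def)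
  next
    fix A U
    assume A: "\<And>n. A n \<in> Omega_at (Cp X Y) (Cp_const X c)" and U: "\<And>n. U n \<in> T n (A n)"
      and cov: "range U \<in> omega_covers X"
    let ?f = "\<lambda>n. R n (A n) (U n)"
    have mem: "?f n \<in> A n" and im: "?f n ` U n \<subseteq> B n" for n
      using R[OF U, of n] by simp_all
    have "?f n \<in> topspace (Cp X Y) \<and> ?f n \<noteq> Cp_const X c" for n
      using mem[of n] A[of n] by (auto simp: Omega_at_def)
    then have sub: "range ?f \<subseteq> topspace (Cp X Y)" and notin: "Cp_const X c \<notin> range ?f"
      by (auto simp: image_iff) metis
    have "\<exists>f\<in>range ?f. f ` F \<subseteq> V"
      if F: "finite F" "F \<subseteq> topspace X" and V: "openin Y V" "c \<in> V" for F V
    proof -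
      obtain m where m: "\<And>n. n \<ge> m \<Longrightarrow> B n \<subseteq> V"
        using B_small V by blast
      \<comment> \<open>One inning has to catch \<open>F\<close> and also be late enough for
        \<open>B n\<close> to lie in \<open>V\<close>.\<close>
      obtain n where "n \<ge> m" "F \<subseteq> U n"
        using omega_cover_sequence_frequently[of X U F m] cov F
        unfolding omega_covers_def by auto
      then have "?f n ` F \<subseteq> V"
        using m im[of n] by (meson image_mono order_trans)
      then show ?thesis by blast
    qed
    then have "Cp_const X c \<in> Cp X Y closure_of range ?f"
      unfolding Cp_const_in_closure_of_iff[OF c sub] by blast
    then show "range ?f \<in> Omega_at (Cp X Y) (Cp_const X c)"
      using sub notin by (simp add: Omega_at_def)
  qed (use R in blast)
qed

section \<open>From fan tightness to omega-covers\<close>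

text \<open>The finite set \<open>F\<close> is compact, so complete regularity separates it from the
  closed complement of \<open>U\<close> by a function into the unit interval;
  \<open>\<gamma>\<close> carries its values 0 and 1 to the required ones.\<close>

lemma Cp_separating_function:
  fixes \<gamma> :: "real \<Rightarrow> 'b"
  assumes X: "completely_regular_space X"
    and \<gamma>: "continuous_map (top_of_set {0..1}) Y \<gamma>"
    and F: "finite F" "F \<subseteq> U" and U: "openin X U"
  obtains f where "f \<in> topspace (Cp X Y)" and "\<And>x. x \<in> F \<Longrightarrow> f x = \<gamma> 0"
    and "\<And>x. x \<in> topspace X - U \<Longrightarrow> f x = \<gamma> 1"
proof -
  have FX: "F \<subseteq> topspace X"
    using F(2) openin_subset[OF U] by blast
  have "compactin X F"
    using FX F(1) by (rule finite_imp_compactin)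
  moreover have "closedin X (topspace X - U)"
    using U by blast
  moreover have "disjnt (topspace X - U) F"
    using F(2) by (auto simp: disjnt_def)
  ultimately obtain h :: "'a \<Rightarrow> real" where h: "continuous_map X (top_of_set {0..1}) h"
      "h ` (topspace X - U) \<subseteq> {1}" "h ` F \<subseteq> {0}"
    using Urysohn_completely_regular_closed_compact[OF zero_le_one X] by metis
  have "continuous_map X Y (\<gamma> \<circ> h)"
    using h(1) \<gamma> by (rule continuous_map_compose)
  \<comment> \<open>Points of \<open>Cp X Y\<close> must be \<open>undefined\<close> outside the
    carrier.\<close>
  then have "continuous_map X Y (restrict (\<gamma> \<circ> h) (topspace X))"
    by (rule continuous_map_eq) simp
  then have "restrict (\<gamma> \<circ> h) (topspace X) \<in> topspace (Cp X Y)"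
    using continuous_map_image_subset_topspace by (fastforce simp: topspace_Cp)
  then show thesis
    by (rule that) (use h(2,3) FX in \<open>auto simp: image_subset_iff\<close>)
qed

text \<open>An answer \<open>f\<close> equals \<open>\<gamma> 1\<close> off the chosen cover member,
  so it can map \<open>F\<close> into the complement of \<open>\<gamma> 1\<close> only if that
  member contains \<open>F\<close>. T1 makes this complement an open neighbourhood of
  \<open>\<gamma> 0\<close>, and clustering supplies such an \<open>f\<close>.\<close>

lemma omega_Rothberger_if_SCFT:
  fixes \<gamma> :: "real \<Rightarrow> 'b"
  assumes X: "completely_regular_space X"
    and Y: "t1_space Y" and \<gamma>: "continuous_map (top_of_set {0..1}) Y \<gamma>" "\<gamma> 0 \<noteq> \<gamma> 1"
    and win: "II_has_winning_strategy_SCFT (Cp X Y) (Cp_const X (\<gamma> 0))"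
  shows "II_has_winning_strategy_G1 (omega_covers X) (omega_covers X)"
proof -
  have \<gamma>Y: "\<gamma> 0 \<in> topspace Y" "\<gamma> 1 \<in> topspace Y"
    using continuous_map_image_subset_topspace[OF \<gamma>(1)] by auto
  define T where
    "T n \<U> = {f \<in> topspace (Cp X Y). \<exists>U\<in>\<U>. \<forall>x\<in>topspace X - U. f x = \<gamma> 1}"
    for n :: nat and \<U> :: "'a set set"
  define R where "R n \<U> f = (SOME U. U \<in> \<U> \<and> (\<forall>x\<in>topspace X - U. f x = \<gamma> 1))"
    for n :: nat and \<U> :: "'a set set" and f :: "'a \<Rightarrow> 'b"
  have R: "R n \<U> f \<in> \<U> \<and> (\<forall>x\<in>topspace X - R n \<U> f. f x = \<gamma> 1)" if "f \<in> T n \<U>" for n \<U> f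
  proof -
    have "\<exists>U. U \<in> \<U> \<and> (\<forall>x\<in>topspace X - U. f x = \<gamma> 1)"
      using that unfolding T_def by blast
    then show ?thesis
      unfolding R_def by (rule someI_ex)
  qed
  show ?thesis
  proof (rule II_has_winning_strategy_G1_transfer
      [OF win[unfolded II_has_winning_strategy_SCFT_def], where T = T and R = R])
    fix n \<U> assume "\<U> \<in> omega_covers X"
    then have cov: "omega_cover X \<U>" by (simp add: omega_covers_def)
    then have cov_finite: "\<exists>U\<in>\<U>. F \<subseteq> U" if "finite F" "F \<subseteq> topspace X" for F
      using that by (simp add: omega_cover_def)
    have sub: "T n \<U> \<subseteq> topspace (Cp X Y)" by (auto simp: T_def)
    have "\<exists>f\<in>T n \<U>. f ` F \<subseteq> V"
      if F: "finite F" "F \<subseteq> topspace X" and V: "\<gamma> 0 \<in> V" for F V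
    proof -
      obtain U where U: "U \<in> \<U>" "F \<subseteq> U"
        using cov_finite[OF F] by blast
      have "openin X U"
        using U(1) cov by (simp add: omega_cover_def)
      obtain f where "f \<in> topspace (Cp X Y)" "\<And>x. x \<in> F \<Longrightarrow> f x = \<gamma> 0"
        "\<And>x. x \<in> topspace X - U \<Longrightarrow> f x = \<gamma> 1"
        using Cp_separating_function[OF X \<gamma>(1) F(1) U(2) \<open>openin X U\<close>] by metis
      then show ?thesis
        using U(1) V by (intro bexI[of _ f]) (auto simp: T_def)
    qed
    then have "Cp_const X (\<gamma> 0) \<in> Cp X Y closure_of T n \<U>"
      unfolding Cp_const_in_closure_of_iff[OF \<gamma>Y(1) sub] by blast
    moreover have "Cp_const X (\<gamma> 0) \<notin> T n \<U>"
    proof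
      assume "Cp_const X (\<gamma> 0) \<in> T n \<U>"
      then obtain U where "U \<in> \<U>" "\<forall>x\<in>topspace X - U. Cp_const X (\<gamma> 0) x = \<gamma> 1"
        by (auto simp: T_def)
      \<comment> \<open>A point outside \<open>U\<close> would force
        \<open>\<gamma> 0 = \<gamma> 1\<close>; but an omega-cover does not contain the whole
        space.\<close>
      then have "topspace X \<subseteq> U"
        using \<gamma>(2) by (auto simp: Cp_const_def)
      then show False
        using cov \<open>U \<in> \<U>\<close> unfolding omega_cover_def
        by (metis openin_subset subset_antisym)
    qed
    ultimately show "T n \<U> \<in> Omega_at (Cp X Y) (Cp_const X (\<gamma> 0))"
      using sub by (simp add: Omega_at_def)
  next
    fix \<U> f
    assume \<U>: "\<And>n. \<U> n \<in> omega_covers X" and f: "\<And>n. f n \<in> T n (\<U> n)"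
      and clus: "range f \<in> Omega_at (Cp X Y) (Cp_const X (\<gamma> 0))"
    let ?U = "\<lambda>n. R n (\<U> n) (f n)"
    have op: "openin X (?U n)" and ne: "?U n \<noteq> topspace X" for n
      using \<U>[of n] R[OF f, of n] by (auto simp: omega_covers_def omega_cover_def)
    have small: "\<exists>n. F \<subseteq> ?U n" if F: "finite F" "F \<subseteq> topspace X" for F
    proof -
      have sub: "range f \<subseteq> topspace (Cp X Y)"
        and cl: "Cp_const X (\<gamma> 0) \<in> Cp X Y closure_of range f"
        using clus by (auto simp: Omega_at_def)
      have "openin Y (topspace Y - {\<gamma> 1})"
        using Y \<gamma>Y(2) by (simp add: openin_diff t1_space_closedin_singleton)
      moreover have "\<gamma> 0 \<in> topspace Y - {\<gamma> 1}"
        using \<gamma>Y \<gamma>(2) by simp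
      ultimately obtain n where "f n ` F \<subseteq> topspace Y - {\<gamma> 1}"
        using iffD1[OF Cp_const_in_closure_of_iff[OF \<gamma>Y(1) sub] cl, rule_format,
            of F "topspace Y - {\<gamma> 1}"] F
        by auto
      then have "F \<subseteq> ?U n"
        using R[OF f, of n] F(2) by blast
      then show ?thesis ..
    qed
    have "topspace X \<subseteq> \<Union>(range ?U)"
    proof
      fix x assume "x \<in> topspace X"
      then show "x \<in> \<Union>(range ?U)" using small[of "{x}"] by auto
    qed
    then have "\<Union>(range ?U) = topspace X"
      using openin_subset[OF op] by blast
    then show "range ?U \<in> omega_covers X"
      unfolding omega_covers_def omega_cover_def mem_Collect_eq
      using op ne small by (metis (no_types, lifting) rangeE rangeI)
  qed (use R in blast)
qed

section \<open>The equivalence for topological groups\<close>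

text \<open>The group is written additively, with \<open>0\<close> as its identity;
  \<open>topological_group_add\<close> does not assume commutativity.\<close>

theorem theorem3p2:
  fixes X :: "'a topology"
  assumes "Tychonoff_space X" and "infinite (topspace X)"
    and "\<exists>g::'g::topological_group_add. g \<noteq> 0"
    and "metrizable_space (euclidean :: 'g topology)"
    and "arc_connected_space (euclidean :: 'g topology)"
  shows "II_has_winning_strategy_G1 (omega_covers X) (omega_covers X) \<longleftrightarrow>
         II_has_winning_strategy_SCFT (Cp X (euclidean :: 'g topology)) (Cp_const X 0)"
proof
  have X: "t1_space X"
    using assms(1) by (simp add: Tychonoff_space_def Hausdorff_imp_t1_space)
  assume "II_has_winning_strategy_G1 (omega_covers X) (omega_covers X)"
  then show "II_has_winning_strategy_SCFT (Cp X (euclidean :: 'g topology)) (Cp_const X 0)"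
    using SCFT_if_omega_Rothberger[OF X assms(2,4)] by simp
next
  have X: "completely_regular_space X"
    using assms(1) by (simp add: Tychonoff_space_def)
  have Y: "t1_space (euclidean :: 'g topology)"
    using assms(4) by (simp add: Hausdorff_imp_t1_space metrizable_imp_Hausdorff_space)
  obtain g :: 'g where "g \<noteq> 0"
    using assms(3) by blast
  then obtain \<gamma> :: "real \<Rightarrow> 'g" where
    \<gamma>: "embedding_map (top_of_set {0..1}) euclidean \<gamma>" "\<gamma> 0 = 0" "\<gamma> 1 = g"
    using assms(5) unfolding arc_connected_space_def by (metis UNIV_I topspace_euclidean)
  \<comment> \<open>An embedding is a homeomorphism onto its image, hence continuous into the whole
    group.\<close>
  then have "continuous_map (top_of_set {0..1}) euclidean \<gamma>"
    unfolding embedding_map_def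
    by (blast dest: homeomorphic_imp_continuous_map continuous_map_into_fulltopology)
  moreover assume "II_has_winning_strategy_SCFT (Cp X (euclidean :: 'g topology)) (Cp_const X 0)"
  ultimately show "II_has_winning_strategy_G1 (omega_covers X) (omega_covers X)"
    using omega_Rothberger_if_SCFT[OF X Y, of \<gamma>] \<gamma>(2,3) \<open>g \<noteq> 0\<close>
    by simp
qed

end
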